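(* Assume the setting and notation of the context (processes, normalizing functions $a_t$, $U_t$, extreme value indices $\gamma_t$, intermediate sequence $(k_n)$, grids $(t_{n,j})$ with mesh $\delta_n\to 0$, interpolation operator $\langle\cdot\rangle_{n,t}$). Let $(\lambda_n)_{n\in\mathbb{N}}$ be a positive bounded sequence. For each $n$ and $t\in[0,1]$ let $\hat\gamma_{n,t}$, $\hat a_{n,t}(n/k_n)$, $\hat U_{n,t}(n/k_n)$ be estimators (real random variables) which, for each $t$, depend only on $X^{(i)}_t$, $1\le i\le n$. Suppose that there are versions of these estimators (denoted by the same symbols) and processes $\Gamma=(\Gamma_t)_{t\in[0,1]}$, $A=(A_t)_{t\in[0,1]}$, $B=(B_t)_{t\in[0,1]}$ with continuous sample paths such that, as $n\to\infty$, $$\sup_{t\in[0,1]} \big|\lambda_n^{-1}(\hat\gamma_{n,t}-\gamma_t)-\Gamma_t \big| \to 0,\qquad \sup_{t\in[0,1]} \bigg|\lambda_n^{-1}\Big(\frac{\hat a_{n,t}(n/k_n)}{a_t(n/k_n)}-1\Big)-A_t \bigg| \to 0,$$ $$\sup_{t\in[0,1]} \bigg|\lambda_n^{-1}\frac{\hat U_{n,t}(n/k_n)-U_t(n/k_n)}{a_t(n/k_n)}-B_t \bigg| \to 0$$ in probability. Suppose further that $$\sup_{|s-t|\le\delta_n}|\gamma_s-\gamma_t| = o(\lambda_n),\qquad \sup_{|s-t|\le\delta_n}\Big|\frac{a_s(n/k_n)}{a_t(n/k_n)}-1\Big| = o(\lambda_n),\qquad \sup_{|s-t|\le\delta_n}\Big|\frac{U_s(n/k_n)-U_t(n/k_n)}{a_t(n/k_n)}\Big|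 = o(\lambda_n).$$ Define the interpolated estimators $\hat\gamma^*_{n,t}:=\langle\hat\gamma_{n}\rangle_{n,t}$, $\hat a^*_{n,t}(n/k_n):=\langle \hat a_{n}(n/k_n)\rangle_{n,t}$, $\hat U^*_{n,t}(n/k_n):=\langle \hat U_{n}(n/k_n)\rangle_{n,t}$, i.e. the interpolation operator is applied to the functions $t\mapsto\hat\gamma_{n,t}$, $t\mapsto\hat a_{n,t}(n/k_n)$, $t\mapsto\hat U_{n,t}(n/k_n)$, where $\hat\gamma_{n,t}$, $\hat a_{n,t}(n/k_n)$, $\hat U_{n,t}(n/k_n)$ denote the versions of the estimators for which the three uniform convergences in probability to $\Gamma$, $A$ and $B$ are assumed to hold. Then, as $n\to\infty$, $$\sup_{t\in[0,1]} \big|\lambda_n^{-1}(\hat\gamma^*_{n,t}-\gamma_t)-\Gamma_t \big| \to 0,\qquad \sup_{t\in[0,1]} \bigg|\lambda_n^{-1}\Big(\frac{\hat a^*_{n,t}(n/k_n)}{a_t(n/k_n)}-1\Big)-A_t \bigg| \to 0,$$ $$\sup_{t\in[0,1]} \bigg|\lambda_n^{-1}\frac{\hat U^*_{n,t}(n/k_n)-U_t(n/k_n)}{a_t(n/k_n)}-B_t \bigg| \to 0$$ in probability.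
   Context: Setting. $X^{(i)}=(X^{(i)}_t)_{t\in[0,1]}$, $i\in\mathbb{N}$, are iid random processes with continuous sample paths; $F_t$ is the cdf of $X^{(1)}_t$, $F_t^{\leftarrow}$ its generalized inverse, and $U_t(u):=F_t^{\leftarrow}(1-1/u)$ for real $u>1$. There are positive normalizing functions $a_t(u)$ ($t\in[0,1]$, $u>0$) such that, with $b_t(n)=U_t(n)$, $$\Big(\max_{1\le i\le n}\frac{X^{(i)}_t-b_t(n)}{a_t(n)}\Big)_{t\in[0,1]}\to (Y_t)_{t\in[0,1]}$$ weakly in $C[0,1]$ as $n\to\infty$, where $Y$ is a max-stable process with margins $P\{Y_t\le y\}=\exp(-(1+\gamma_t y)^{-1/\gamma_t})$ for $1+\gamma_t y>0$ (read as $\exp(-e^{-y})$ if $\gamma_t=0$), for some continuous function $t\mapsto\gamma_t\in\mathbb{R}$ on $[0,1]$. $(k_n)_{n\in\mathbb{N}}$ is an intermediate sequence: $k_n\in\{1,\dots,n\}$, $k_n\to\infty$, $k_n/n\to0$. Grid. For each $n$, points $t_{n,1}<t_{n,2}<\dots<t_{n,j_n}$ in $[0,1]$ are given. With $t_{n,0}:=0$, $t_{n,j_n+1}:=1$, put $\delta_n:=\max_{1\le j\le j_n+1}(t_{n,j}-t_{n,j-1})$; it is assumed that $\delta_n\to0$ as $n\to\infty$. The notation $\sup_{|s-t|\le\delta_n}$ means the supremum over all $s,t\in[0,1]$ with $|s-t|\le\delta_n$. Interpolation. For a function $z=(z_t)_{t\in[0,1]}$: $\langle z\rangle_{n,t}:=z_{t_{n,1}}$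 if $t\le t_{n,1}$; $\langle z\rangle_{n,t}:=\frac{t_{n,j}-t}{t_{n,j}-t_{n,j-1}}z_{t_{n,j-1}}+\frac{t-t_{n,j-1}}{t_{n,j}-t_{n,j-1}}z_{t_{n,j}}$ if $t_{n,j-1}<t\le t_{n,j}$ for some $2\le j\le j_n$; $\langle z\rangle_{n,t}:=z_{t_{n,j_n}}$ if $t>t_{n,j_n}$. *)

theory Defs
  imports "HOL-Probability.Probability"
begin

section \<open>Processes indexed by the unit interval\<close>

definition random_process :: "'a measure \<Rightarrow> (real \<Rightarrow> 'a \<Rightarrow> 'e::topological_space) \<Rightarrow> bool" where
  "random_process M Z \<longleftrightarrow> (\<forall>t\<in>{0..1}. Z t \<in> borel_measurable M)"

definition continuous_process :: "'a measure \<Rightarrow> (real \<Rightarrow> 'a \<Rightarrow> real) \<Rightarrow> bool" where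
  "continuous_process M Z \<longleftrightarrow>
     random_process M Z \<and> (\<forall>\<omega>\<in>space M. continuous_on {0..1} (\<lambda>t. Z t \<omega>))"

definition sample_path :: "(real \<Rightarrow> 'a \<Rightarrow> 'e) \<Rightarrow> 'a \<Rightarrow> real \<Rightarrow> 'e" where
  "sample_path Z \<omega> = (\<lambda>t\<in>{0..1}. Z t \<omega>)"

definition process_law ::
  "'a measure \<Rightarrow> (real \<Rightarrow> 'a \<Rightarrow> 'e::topological_space) \<Rightarrow> (real \<Rightarrow> 'e) measure" where
  "process_law M Z = distr M (Pi\<^sub>M {0..1} (\<lambda>_. borel)) (sample_path Z)"

text \<open>A version may live on a different probability space; only the law is preserved.\<close>

definition version_of ::
  "'b measure \<Rightarrow> (real \<Rightarrow> 'b \<Rightarrow> 'e::topological_space) \<Rightarrow>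
   'a measure \<Rightarrow> (real \<Rightarrow> 'a \<Rightarrow> 'e) \<Rightarrow> bool" where
  "version_of N V M Z \<longleftrightarrow>
     random_process N V \<and> random_process M Z \<and> process_law N V = process_law M Z"

definition iid_processes :: "'a measure \<Rightarrow> (nat \<Rightarrow> real \<Rightarrow> 'a \<Rightarrow> real) \<Rightarrow> nat set \<Rightarrow> bool" where
  "iid_processes M X I \<longleftrightarrow>
     prob_space.indep_vars M (\<lambda>_. Pi\<^sub>M {0..1} (\<lambda>_. borel)) (\<lambda>i. sample_path (X i)) I \<and>
     (\<forall>i\<in>I. \<forall>j\<in>I. process_law M (X i) = process_law M (X j))"


section \<open>Weak convergence in the space of continuous functions\<close>

definition C01 :: "(real \<Rightarrow> real) metric" where
  "C01 = cfunspace (top_of_set {0..1}) euclidean_metric"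

text \<open>
  The normalized maxima are not defined for \<open>n = 0\<close> (empty maximum) and \<open>n = 1\<close> (the centering
  constant needs \<open>n > 1\<close>), so \<open>Z n\<close> is required to be a random element of \<open>C01\<close> only
  eventually. A bounded continuous functional then has a measurable composition with the paths,
  as the Borel sets of \<open>C01\<close> are generated by the coordinates.
\<close>

definition weak_conv_C01 ::
  "'a measure \<Rightarrow> (nat \<Rightarrow> real \<Rightarrow> 'a \<Rightarrow> real) \<Rightarrow> 'b measure \<Rightarrow> (real \<Rightarrow> 'b \<Rightarrow> real) \<Rightarrow> bool" where
  "weak_conv_C01 M Z L Y \<longleftrightarrow>
     (\<forall>\<^sub>F n in sequentially. continuous_process M (Z n)) \<and> continuous_process L Y \<and>
     (\<forall>\<Phi>. continuous_map (mtopology_of C01) euclideanreal \<Phi> \<and> bounded (\<Phi> ` mspace C01) \<longrightarrow>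
        (\<lambda>n. \<integral>\<omega>. \<Phi> (sample_path (Z n) \<omega>) \<partial>M) \<longlonglongrightarrow> (\<integral>\<omega>. \<Phi> (sample_path Y \<omega>) \<partial>L))"


section \<open>Extreme value theory\<close>

definition gen_inverse :: "(real \<Rightarrow> real) \<Rightarrow> real \<Rightarrow> real" where
  "gen_inverse F p = Inf {x. p \<le> F x}"

text \<open>
  Only meaningful for \<open>u > 1\<close>; for \<open>u = 1\<close> (i.e. level 0) the infimum of all reals
  is an unspecified number.
\<close>

definition tail_quantile :: "'a measure \<Rightarrow> (real \<Rightarrow> 'a \<Rightarrow> real) \<Rightarrow> real \<Rightarrow> real \<Rightarrow> real" where
  "tail_quantile M Z t u = gen_inverse (cdf (distr M borel (Z t))) (1 - 1 / u)"

definition normalized_max ::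
  "(nat \<Rightarrow> real \<Rightarrow> 'a \<Rightarrow> real) \<Rightarrow> (real \<Rightarrow> real) \<Rightarrow> (real \<Rightarrow> real) \<Rightarrow> nat \<Rightarrow> real \<Rightarrow> 'a \<Rightarrow> real" where
  "normalized_max X a b n t \<omega> = Max ((\<lambda>i. (X i t \<omega> - b t) / a t) ` {1..n})"

definition gev_cdf :: "real \<Rightarrow> real \<Rightarrow> real" where
  "gev_cdf \<gamma> y = (if \<gamma> = 0 then exp (- exp (- y)) else exp (- ((1 + \<gamma> * y) powr (- 1 / \<gamma>))))"

text \<open>The independent copies of the process are the coordinates of a product space.\<close>

definition max_stable :: "'a measure \<Rightarrow> (real \<Rightarrow> 'a \<Rightarrow> real) \<Rightarrow> bool" where
  "max_stable L Y \<longleftrightarrow>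
     random_process L Y \<and>
     (\<forall>m\<ge>1. \<exists>c d. (\<forall>t\<in>{0..1}. c t > 0) \<and>
        process_law (Pi\<^sub>M {1..m} (\<lambda>_. L)) (normalized_max (\<lambda>i t \<omega>. Y t (\<omega> i)) c d m)
          = process_law L Y)"


section \<open>Grids and interpolation\<close>

definition grid_ext :: "(nat \<Rightarrow> real) \<Rightarrow> nat \<Rightarrow> nat \<Rightarrow> real" where
  "grid_ext \<tau> J j = (if j = 0 then 0 else if j = J + 1 then 1 else \<tau> j)"

definition mesh :: "(nat \<Rightarrow> real) \<Rightarrow> nat \<Rightarrow> real" where
  "mesh \<tau> J = Max ((\<lambda>j. grid_ext \<tau> J j - grid_ext \<tau> J (j - 1)) ` {1..J + 1})"

definition interpolate :: "(nat \<Rightarrow> real) \<Rightarrow> nat \<Rightarrow> (real \<Rightarrow> real) \<Rightarrow> real \<Rightarrow> real" where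
  "interpolate \<tau> J z t =
     (if t \<le> \<tau> 1 then z (\<tau> 1)
      else if t > \<tau> J then z (\<tau> J)
      else let j = (THE j. j \<in> {2..J} \<and> \<tau> (j - 1) < t \<and> t \<le> \<tau> j)
           in (\<tau> j - t) / (\<tau> j - \<tau> (j - 1)) * z (\<tau> (j - 1))
            + (t - \<tau> (j - 1)) / (\<tau> j - \<tau> (j - 1)) * z (\<tau> j))"


section \<open>Suprema and convergence in probability\<close>

text \<open>Suprema are taken in the extended reals, so that unbounded functions have supremum \<open>\<infinity>\<close>.\<close>

definition sup01 :: "(real \<Rightarrow> real) \<Rightarrow> ereal" where
  "sup01 f = (SUP t\<in>{0..1}. ereal \<bar>f t\<bar>)"

definition sup_near :: "real \<Rightarrow> (real \<Rightarrow> real \<Rightarrow> real) \<Rightarrow> ereal" where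
  "sup_near \<delta> f = (SUP (s, t)\<in>{(s, t). s \<in> {0..1} \<and> t \<in> {0..1} \<and> \<bar>s - t\<bar> \<le> \<delta>}. ereal \<bar>f s t\<bar>)"

definition small_oh :: "(nat \<Rightarrow> ereal) \<Rightarrow> (nat \<Rightarrow> real) \<Rightarrow> bool" where
  "small_oh e r \<longleftrightarrow> (\<lambda>n. e n / ereal (r n)) \<longlonglongrightarrow> 0"

text \<open>
  A supremum over uncountably many random variables need not be measurable, hence the outer
  measure; it is the probability itself on measurable events.
\<close>

definition tendsto_zero_in_prob :: "'a measure \<Rightarrow> (nat \<Rightarrow> 'a \<Rightarrow> ereal) \<Rightarrow> bool" where
  "tendsto_zero_in_prob M Z \<longleftrightarrow>
     (\<forall>\<epsilon>>0. (\<lambda>n. outer_measure_of M {\<omega>\<in>space M. \<bar>Z n \<omega>\<bar> > ereal \<epsilon>}) \<longlonglongrightarrow> 0)"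

end

(* On [0,1] the interpolation at t is a convex combination of the values at grid points within
   distance delta_n of t, with weights that do not depend on the function. All three claims are
   therefore one statement about h = c + d lam (G + R), with centering c, scale d and error R:
   at a point p near t,
     (h_p - c_t)/(d_t lam) - G_t
       = R_p + (G_p - G_t) + (d_p/d_t - 1)(R_p + G_p) + (c_p - c_t)/(d_t lam),
   and each summand is uniformly small with high probability, since a process with continuous
   paths is bounded and equicontinuous in probability on [0,1]. *)
theory Submission
  imports Defs
begin

section \<open>Suprema, outer probability and small-oh rates\<close>

text \<open>Because the inequality is strict, a supremum exceeds \<open>\<epsilon>\<close> exactly
  when some single point does. This trades extended-real suprema for existential events, on which
  all later estimates work.\<close>

lemma prob_sup01_tendsto_zero_iff:
  "tendsto_zero_in_prob M (\<lambda>n \<omega>. sup01 (f n \<omega>)) \<longleftrightarrow>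
     (\<forall>\<epsilon>>0. (\<lambda>n. outer_measure_of M {\<omega>\<in>space M. \<exists>t\<in>{0..1}. \<bar>f n \<omega> t\<bar> > \<epsilon>}) \<longlonglongrightarrow> 0)"
proof -
  have "0 \<le> sup01 g" for g
    unfolding sup01_def by (rule SUP_upper2[of 0]) auto
  then have "\<bar>sup01 g\<bar> = sup01 g" for g
    by simp
  then have "ereal \<epsilon> < \<bar>sup01 g\<bar> \<longleftrightarrow> (\<exists>t\<in>{0..1}. \<bar>g t\<bar> > \<epsilon>)" for \<epsilon> g
    by (simp add: sup01_def less_SUP_iff)
  then show ?thesis
    unfolding tendsto_zero_in_prob_def by simp
qed

text \<open>Agreement is asked for \<open>n \<ge> 1\<close> only: at \<open>n = 0\<close> the scale
  would be \<open>a t 0\<close>, whose sign is not known, and rewriting with it would fail.\<close>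

lemma tendsto_zero_in_prob_cong:
  assumes "\<And>n \<omega>. n \<ge> 1 \<Longrightarrow> \<omega> \<in> space M \<Longrightarrow> Z n \<omega> = Z' n \<omega>"
  shows "tendsto_zero_in_prob M Z \<longleftrightarrow> tendsto_zero_in_prob M Z'"
proof -
  have "\<forall>\<^sub>F n in sequentially. outer_measure_of M {\<omega>\<in>space M. \<bar>Z n \<omega>\<bar> > ereal \<epsilon>} =
      outer_measure_of M {\<omega>\<in>space M. \<bar>Z' n \<omega>\<bar> > ereal \<epsilon>}" for \<epsilon>
    using eventually_ge_at_top[of 1]
    by eventually_elim (auto simp: assms intro!: arg_cong[where f = "outer_measure_of M"])
  then show ?thesis
    unfolding tendsto_zero_in_prob_def by (intro all_cong tendsto_cong)
qed

lemma small_oh_cong: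
  assumes "\<And>n. n \<ge> 1 \<Longrightarrow> e n = e' n"
  shows "small_oh e r \<longleftrightarrow> small_oh e' r"
  unfolding small_oh_def
  by (intro tendsto_cong eventually_mono[OF eventually_ge_at_top[of 1]]) (simp add: assms)

text \<open>Each set has a measurable superset attaining its outer measure, so subadditivity of the
  measure carries over. The estimator events below are not known to be measurable.\<close>

lemma outer_measure_of_Un_le:
  assumes "A \<subseteq> space M" "B \<subseteq> space M"
  shows "outer_measure_of M (A \<union> B) \<le> outer_measure_of M A + outer_measure_of M B"
proof -
  obtain A' where A': "A' \<in> sets M" "A \<subseteq> A'" "outer_measure_of M A = emeasure M A'"
    using outer_measure_of_attain[OF assms(1)] by blast
  obtain B' where B': "B' \<in> sets M" "B \<subseteq> B'" "outer_measure_of M B = emeasure M B'"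
    using outer_measure_of_attain[OF assms(2)] by blast
  have "outer_measure_of M (A \<union> B) \<le> outer_measure_of M (A' \<union> B')"
    using A' B' by (intro outer_measure_of_mono) auto
  also have "\<dots> \<le> emeasure M A' + emeasure M B'"
    using A' B' by (simp add: emeasure_subadditive)
  finally show ?thesis
    using A' B' by simp
qed

lemma small_oh_sup_nearD:
  assumes "small_oh (\<lambda>n. sup_near (\<delta> n) (f n)) r" "\<And>n. n \<ge> 1 \<Longrightarrow> r n > 0" "\<epsilon> > 0"
  shows "\<forall>\<^sub>F n in sequentially. \<forall>s\<in>{0..1}. \<forall>t\<in>{0..1}. \<bar>s - t\<bar> \<le> \<delta> n \<longrightarrow> \<bar>f n s t\<bar> < \<epsilon> * r n"
proof -
  have "\<forall>\<^sub>F n in sequentially. sup_near (\<delta> n) (f n) / ereal (r n) < ereal \<epsilon>"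
    using assms(1,3) unfolding small_oh_def by (intro order_tendstoD) auto
  then show ?thesis
    using eventually_ge_at_top[of 1]
  proof eventually_elim
    case (elim n)
    then have *: "sup_near (\<delta> n) (f n) < ereal (\<epsilon> * r n)"
      using assms(2)[of n] by (simp add: ereal_divide_less_iff mult.commute)
    show ?case
    proof (intro ballI impI)
      fix s t :: real assume "s \<in> {0..1}" "t \<in> {0..1}" "\<bar>s - t\<bar> \<le> \<delta> n"
      then have "ereal \<bar>f n s t\<bar> \<le> sup_near (\<delta> n) (f n)"
        unfolding sup_near_def by (intro SUP_upper2[of "(s, t)"]) auto
      then show "\<bar>f n s t\<bar> < \<epsilon> * r n"
        using * by (metis ereal_less(1) ereal_less_eq(3) le_less_trans less_ereal.simps(1))
    qed
  qed
qed

section \<open>Interpolation as a local convex combination\<close>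

lemma grid_gap_le_mesh:
  "j \<in> {1..J + 1} \<Longrightarrow> grid_ext \<tau> J j - grid_ext \<tau> J (j - 1) \<le> mesh \<tau> J"
  unfolding mesh_def by (intro Max_ge) auto

text \<open>The nodes and the weight are fixed before \<open>z\<close> is quantified: they depend on
  the grid and on \<open>t\<close> alone. Hence one choice serves every sample path.\<close>

lemma interpolate_convex_combination:
  assumes J: "J \<ge> 1" and grid: "\<And>j. j \<in> {1..J} \<Longrightarrow> \<tau> j \<in> {0..1}"
    and mono: "strict_mono_on {1..J} \<tau>" and t: "t \<in> {0..1}"
  obtains p q w where "p \<in> {0..1}" "q \<in> {0..1}" "\<bar>p - t\<bar> \<le> mesh \<tau> J" "\<bar>q - t\<bar> \<le> mesh \<tau> J"
    "w \<in> {0..1}" "\<And>z. interpolate \<tau> J z t = w * z p + (1 - w) * z q"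
proof -
  consider "t \<le> \<tau> 1" | "\<tau> 1 < t" "t > \<tau> J" | "\<tau> 1 < t" "t \<le> \<tau> J" by linarith
  then show ?thesis
  proof cases
    case 1
    \<comment> \<open>The mesh includes the gaps from 0 to the first node and from the last node to
      1, so the constant pieces at both ends are also within mesh distance.\<close>
    show ?thesis
      by (rule that[of "\<tau> 1" "\<tau> 1" 1])
         (use 1 J grid[of 1] t grid_gap_le_mesh[of 1 J \<tau>] in \<open>auto simp: grid_ext_def interpolate_def\<close>)
  next
    case 2
    show ?thesis
      by (rule that[of "\<tau> J" "\<tau> J" 1])
         (use 2 J grid[of J] t grid_gap_le_mesh[of "J + 1" J \<tau>] in \<open>auto simp: grid_ext_def interpolate_def\<close>)
  next
    case 3
    \<comment> \<open>The first node not to the left of \<open>t\<close>. As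
      \<open>\<tau> 1 < t\<close>, it has a predecessor, which lies strictly left of
      \<open>t\<close> by minimality.\<close>
    define j where "j = (LEAST j. j \<ge> 1 \<and> t \<le> \<tau> j)"
    have j: "j \<ge> 1" "t \<le> \<tau> j"
      using LeastI[of "\<lambda>j. j \<ge> 1 \<and> t \<le> \<tau> j" J] J 3 unfolding j_def by auto
    have "j \<le> J"
      unfolding j_def using J 3 by (intro Least_le) auto
    have "j \<noteq> 1"
      using j 3 by auto
    then have "j \<ge> 2"
      using j by simp
    have below: "\<tau> (j - 1) < t"
      using not_less_Least[of "j - 1" "\<lambda>j. j \<ge> 1 \<and> t \<le> \<tau> j"] \<open>j \<ge> 2\<close> unfolding j_def[symmetric]
      by auto
    have le: "\<tau> i \<le> \<tau> i'" if "i \<in> {1..J}" "i' \<in> {1..J}" "i \<le> i'" for i i'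
      using mono that by (metis strict_mono_on_leD)
    \<comment> \<open>The half-open intervals between consecutive nodes are disjoint: by
      monotonicity, any other index would put \<open>t\<close> on the wrong side of a node.\<close>
    have the_j: "(THE j. j \<in> {2..J} \<and> \<tau> (j - 1) < t \<and> t \<le> \<tau> j) = j"
    proof (rule the_equality)
      show "j \<in> {2..J} \<and> \<tau> (j - 1) < t \<and> t \<le> \<tau> j"
        using \<open>j \<ge> 2\<close> \<open>j \<le> J\<close> below j by auto
      fix i assume i: "i \<in> {2..J} \<and> \<tau> (i - 1) < t \<and> t \<le> \<tau> i"
      show "i = j"
      proof (rule ccontr)
        assume "i \<noteq> j"
        then consider "i \<le> j - 1" | "j \<le> i - 1" by linarith
        then show False
        proof cases
          case 1
          then show False using le[of i "j - 1"] i below \<open>j \<ge> 2\<close> \<open>j \<le> J\<close>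
            by (simp add: le_diff_conv)
        next
          case 2
          then show False using le[of j "i - 1"] i j \<open>j \<ge> 2\<close> \<open>j \<le> J\<close>
            by (simp add: le_diff_conv)
        qed
      qed
    qed
    define w where "w = (\<tau> j - t) / (\<tau> j - \<tau> (j - 1))"
    have w': "1 - w = (t - \<tau> (j - 1)) / (\<tau> j - \<tau> (j - 1))"
      using below j unfolding w_def by (simp add: field_simps)
    \<comment> \<open>Here \<open>1 \<le> j - 1\<close> and \<open>j \<le> J\<close>, so neither
      index is one of the added endpoints 0 and \<open>J + 1\<close>, and \<open>grid_ext\<close>
      agrees with \<open>\<tau>\<close>.\<close>
    have gap: "\<tau> j - \<tau> (j - 1) \<le> mesh \<tau> J"
      using grid_gap_le_mesh[of j J \<tau>] \<open>j \<ge> 2\<close> \<open>j \<le> J\<close>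
      by (auto simp: grid_ext_def split: if_splits)
    show ?thesis
    proof (rule that[of "\<tau> (j - 1)" "\<tau> j" w])
      show "\<tau> (j - 1) \<in> {0..1}" "\<tau> j \<in> {0..1}"
        using \<open>j \<ge> 2\<close> \<open>j \<le> J\<close> by (intro grid; simp; linarith)+
      show "w \<in> {0..1}"
        using below j unfolding w_def by (auto simp: field_simps)
      show "interpolate \<tau> J z t = w * z (\<tau> (j - 1)) + (1 - w) * z (\<tau> j)" for z
        using 3 unfolding interpolate_def the_j Let_def w' by (simp add: w_def)
    qed (use gap below j in auto)
  qed
qed

section \<open>Boundedness and equicontinuity in probability of continuous processes\<close>

text \<open>By continuity the set of \<open>p\<close> with value in \<open>V\<close> is relatively
  open in \<open>S\<close>, so if nonempty it meets a countable dense subset. The uncountable union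
  thus becomes a countable one.\<close>

lemma sets_Collect_ex_continuous:
  fixes F :: "'a::{second_countable_topology,metric_space} \<Rightarrow> 'b \<Rightarrow> 'c::topological_space"
  assumes meas: "\<And>p. p \<in> S \<Longrightarrow> F p \<in> borel_measurable M"
    and cont: "\<And>\<omega>. \<omega> \<in> space M \<Longrightarrow> continuous_on S (\<lambda>p. F p \<omega>)"
    and V: "open V"
  shows "{\<omega>\<in>space M. \<exists>p\<in>S. F p \<omega> \<in> V} \<in> sets M"
proof -
  obtain D where D: "countable D" "D \<subseteq> S" "S \<subseteq> closure D"
    using separable[of S] by blast
  have "(\<exists>p\<in>S. F p \<omega> \<in> V) \<longleftrightarrow> (\<exists>p\<in>D. F p \<omega> \<in> V)" if \<omega>: "\<omega> \<in> space M" for \<omega>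
  proof
    assume "\<exists>p\<in>S. F p \<omega> \<in> V"
    then obtain p where p: "p \<in> S" "F p \<omega> \<in> V" by auto
    obtain W where W: "open W" "W \<inter> S = (\<lambda>p. F p \<omega>) -` V \<inter> S"
      using cont[OF \<omega>] V unfolding continuous_on_open_invariant by blast
    then have "W \<inter> closure D \<noteq> {}"
      using p D by auto
    then have "W \<inter> D \<noteq> {}"
      using W(1) open_Int_closure_eq_empty by blast
    then show "\<exists>p\<in>D. F p \<omega> \<in> V"
      using W D by blast
  qed (use D in auto)
  then have "{\<omega>\<in>space M. \<exists>p\<in>S. F p \<omega> \<in> V} = (\<Union>p\<in>D. F p -` V \<inter> space M)"
    by auto
  also have "\<dots> \<in> sets M"
    using D by (intro sets.countable_UN') (auto intro: measurable_sets meas borel_open V)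
  finally show ?thesis .
qed

text \<open>Here \<open>1 / m = 0\<close> for \<open>m = 0\<close>, hence the shifted index in the second disjunct.\<close>

lemma continuous_process_tight:
  assumes "prob_space N" and G: "continuous_process N G" and "\<eta> > 0"
  shows "(\<lambda>m. outer_measure_of N {\<omega>\<in>space N. (\<exists>s\<in>{0..1}. \<bar>G s \<omega>\<bar> > real m) \<or>
    (\<exists>s\<in>{0..1}. \<exists>t\<in>{0..1}. \<bar>s - t\<bar> < 1 / real (Suc m) \<and> \<bar>G s \<omega> - G t \<omega>\<bar> > \<eta>)}) \<longlonglongrightarrow> 0"
    (is "(\<lambda>m. outer_measure_of N (?E m)) \<longlonglongrightarrow> 0")
proof -
  interpret prob_space N by fact
  have meas: "G t \<in> borel_measurable N" if "t \<in> {0..1}" for t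
    using G that by (auto simp: continuous_process_def random_process_def)
  have cont: "continuous_on {0..1} (\<lambda>t. G t \<omega>)" if "\<omega> \<in> space N" for \<omega>
    using G that by (auto simp: continuous_process_def)
  \<comment> \<open>Treating a pair of times as one parameter makes the oscillation event an
    instance of the preceding measurability lemma.\<close>
  define S where "S m = {(s::real, t::real). s \<in> {0..1} \<and> t \<in> {0..1} \<and> \<bar>s - t\<bar> < 1 / real (Suc m)}" for m
  have E_eq: "?E m = {\<omega>\<in>space N. \<exists>s\<in>{0..1}. G s \<omega> \<in> {x. \<bar>x\<bar> > real m}} \<union>
      {\<omega>\<in>space N. \<exists>p\<in>S m. G (fst p) \<omega> - G (snd p) \<omega> \<in> {x. \<bar>x\<bar> > \<eta>}}" for m
    unfolding S_def by force
  have E_sets: "?E m \<in> sets N" for m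
    unfolding E_eq
  proof (intro sets.Un sets_Collect_ex_continuous)
    show "open {x::real. \<bar>x\<bar> > real m}" "open {x::real. \<bar>x\<bar> > \<eta>}"
      by (intro open_Collect_less continuous_intros)+
    fix \<omega> assume \<omega>: "\<omega> \<in> space N"
    show "continuous_on (S m) (\<lambda>p. G (fst p) \<omega> - G (snd p) \<omega>)"
      by (intro continuous_on_diff continuous_on_compose2[OF cont[OF \<omega>]] continuous_intros)
         (auto simp: S_def)
  qed (use meas cont in \<open>auto simp: S_def\<close>)
  have "decseq ?E"
  proof (rule decseq_SucI, intro Collect_mono impI)
    fix m \<omega>
    have le: "real m \<le> real (Suc m)" "1 / real (Suc (Suc m)) \<le> 1 / real (Suc m)"
      by (auto simp: field_simps)
    show "\<omega> \<in> space N \<and> ((\<exists>s\<in>{0..1}. \<bar>G s \<omega>\<bar> > real (Suc m)) \<or>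
        (\<exists>s\<in>{0..1}. \<exists>t\<in>{0..1}. \<bar>s - t\<bar> < 1 / real (Suc (Suc m)) \<and> \<bar>G s \<omega> - G t \<omega>\<bar> > \<eta>))
      \<Longrightarrow> \<omega> \<in> space N \<and> ((\<exists>s\<in>{0..1}. \<bar>G s \<omega>\<bar> > real m) \<or>
        (\<exists>s\<in>{0..1}. \<exists>t\<in>{0..1}. \<bar>s - t\<bar> < 1 / real (Suc m) \<and> \<bar>G s \<omega> - G t \<omega>\<bar> > \<eta>))"
      using le by (meson le_less_trans less_le_trans)
  qed
  \<comment> \<open>On the compact interval a continuous path is bounded and uniformly continuous,
    so it leaves \<open>?E m\<close> once \<open>m\<close> is large. Continuity from above of the
    finite measure then gives the limit.\<close>
  moreover have "(\<Inter>m. ?E m) = {}"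
  proof (rule equals0I)
    fix \<omega> assume E: "\<omega> \<in> (\<Inter>m. ?E m)"
    then have \<omega>: "\<omega> \<in> space N" by auto
    have "bounded ((\<lambda>t. G t \<omega>) ` {0..1})"
      using cont[OF \<omega>] by (intro compact_imp_bounded compact_continuous_image) auto
    then obtain b where b: "\<And>t. t \<in> {0..1} \<Longrightarrow> \<bar>G t \<omega>\<bar> \<le> b"
      unfolding bounded_iff by (metis imageI real_norm_def)
    have "uniformly_continuous_on {0..1} (\<lambda>t. G t \<omega>)"
      using cont[OF \<omega>] by (intro compact_uniformly_continuous) auto
    then obtain d where d: "d > 0"
      "\<And>s t. s \<in> {0..1} \<Longrightarrow> t \<in> {0..1} \<Longrightarrow> \<bar>s - t\<bar> < d \<Longrightarrow> \<bar>G s \<omega> - G t \<omega>\<bar> < \<eta>"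
      unfolding uniformly_continuous_on_def dist_real_def using \<open>\<eta> > 0\<close> by metis
    obtain m1 where m1: "b \<le> real m1"
      using real_arch_simple by blast
    obtain m2 where m2: "inverse (real (Suc m2)) < d"
      using reals_Archimedean[OF d(1)] by blast
    define m where "m = max m1 m2"
    have "b \<le> real m" "1 / real (Suc m) < d"
    proof -
      show "b \<le> real m" using m1 by (auto simp: m_def)
      have "1 / real (Suc m) \<le> 1 / real (Suc m2)"
        by (intro divide_left_mono) (auto simp: m_def)
      then show "1 / real (Suc m) < d"
        using m2 by (simp add: inverse_eq_divide)
    qed
    moreover have "\<omega> \<in> ?E m" using E by blast
    ultimately show False
      using b d(2) by (smt (verit, best) mem_Collect_eq)
  qed
  ultimately have "(\<lambda>m. emeasure N (?E m)) \<longlonglongrightarrow> 0"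
    using Lim_emeasure_decseq[of ?E N] E_sets by (auto simp: image_subset_iff)
  then show ?thesis
    using E_sets by simp
qed

section \<open>From the error at nearby points to uniform convergence\<close>

text \<open>Primed quantities belong to a nearby point \<open>p\<close>, as does the value
  \<open>h\<close>; unprimed ones belong to \<open>t\<close>. The error splits into four summands,
  each at most \<open>\<eta>\<close>.\<close>

lemma interpolation_error_bound:
  fixes h c c' d d' l G G' \<eta> m :: real
  assumes "d > 0" "d' > 0" "l > 0" "0 < \<eta>" "\<eta> \<le> 1" "m \<ge> 0"
    and R: "\<bar>(h - c') / d' / l - G'\<bar> \<le> \<eta>" and G: "\<bar>G'\<bar> \<le> m" "\<bar>G' - G\<bar> \<le> \<eta>"
    and c: "\<bar>(c' - c) / d\<bar> < \<eta> * l" and d: "\<bar>d' / d - 1\<bar> \<le> \<eta> / (m + 1)"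
  shows "\<bar>(h - c) / d / l - G\<bar> \<le> 4 * \<eta>"
proof -
  define R where "R = (h - c') / d' / l - G'"
  define C where "C = (c' - c) / d / l"
  define e where "e = d' / d - 1"
  have R': "\<bar>R\<bar> \<le> \<eta>" using R by (simp add: R_def)
  have C: "\<bar>C\<bar> \<le> \<eta>"
  proof -
    have "\<bar>C\<bar> = \<bar>(c' - c) / d\<bar> / l"
      using \<open>l > 0\<close> by (simp add: C_def abs_mult)
    then show ?thesis
      using c \<open>l > 0\<close> pos_divide_le_eq[of l "\<bar>(c' - c) / d\<bar>" \<eta>] by linarith
  qed
  \<comment> \<open>The denominator \<open>m + 1\<close> in the bound on \<open>e\<close> is chosen
    to cancel \<open>\<bar>R + G'\<bar> \<le> \<eta> + m \<le> m + 1\<close>, where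
    \<open>\<eta> \<le> 1\<close> enters.\<close>
  have "\<bar>e * (R + G')\<bar> \<le> \<eta> / (m + 1) * (m + 1)"
    unfolding abs_mult using d R' G \<open>\<eta> \<le> 1\<close> \<open>m \<ge> 0\<close> \<open>0 < \<eta>\<close>
    by (intro mult_mono) (auto simp: e_def)
  then have eR: "\<bar>e * (R + G')\<bar> \<le> \<eta>"
    using \<open>m \<ge> 0\<close> by simp
  have "(h - c) / d / l - G = R + (G' - G) + e * (R + G') + C"
    using \<open>d > 0\<close> \<open>d' > 0\<close> \<open>l > 0\<close> by (simp add: R_def C_def e_def field_simps)
  then show ?thesis
    using R' C eR G by linarith
qed

text \<open>For fixed \<open>m\<close> and all large \<open>n\<close>, the bad event lies in the
  union of \<open>R n\<close>, where the original estimator is off, and \<open>E m\<close>, where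
  the limit path is large or oscillates. Since \<open>E m\<close> does not involve \<open>n\<close>,
  \<open>m\<close> can be chosen first and then \<open>n\<close> sent to infinity.\<close>

lemma interpolate_uniform_convergence:
  fixes h :: "nat \<Rightarrow> real \<Rightarrow> 'a \<Rightarrow> real" and c d :: "nat \<Rightarrow> real \<Rightarrow> real"
  assumes N: "prob_space N" and G: "continuous_process N G"
    and J: "\<And>n. n \<ge> 1 \<Longrightarrow> J n \<ge> 1"
    and grid: "\<And>n j. n \<ge> 1 \<Longrightarrow> j \<in> {1..J n} \<Longrightarrow> \<tau> n j \<in> {0..1}"
    and mono: "\<And>n. n \<ge> 1 \<Longrightarrow> strict_mono_on {1..J n} (\<tau> n)"
    and mesh: "(\<lambda>n. mesh (\<tau> n) (J n)) \<longlonglongrightarrow> 0"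
    and lam: "\<And>n. n \<ge> 1 \<Longrightarrow> lam n > 0" and bdd: "bounded (range lam)"
    and d_pos: "\<And>n t. n \<ge> 1 \<Longrightarrow> t \<in> {0..1} \<Longrightarrow> d n t > 0"
    and conv: "tendsto_zero_in_prob N
      (\<lambda>n \<omega>. sup01 (\<lambda>t. (h n t \<omega> - c n t) / d n t / lam n - G t \<omega>))"
    and c: "small_oh (\<lambda>n. sup_near (mesh (\<tau> n) (J n)) (\<lambda>s t. (c n s - c n t) / d n t)) lam"
    and d: "small_oh (\<lambda>n. sup_near (mesh (\<tau> n) (J n)) (\<lambda>s t. d n s / d n t - 1)) lam"
  shows "tendsto_zero_in_prob N (\<lambda>n \<omega>. sup01 (\<lambda>t.
    (interpolate (\<tau> n) (J n) (\<lambda>s. h n s \<omega>) t - c n t) / d n t / lam n - G t \<omega>))"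
  unfolding prob_sup01_tendsto_zero_iff
proof (intro allI impI)
  fix \<epsilon> :: real assume "\<epsilon> > 0"
  \<comment> \<open>The 4 counts the summands in the pointwise bound; the cap at 1 is the condition
    \<open>\<eta> \<le> 1\<close> of that bound.\<close>
  define \<eta> where "\<eta> = min 1 (\<epsilon> / 4)"
  have \<eta>: "0 < \<eta>" "\<eta> \<le> 1" "4 * \<eta> \<le> \<epsilon>"
    using \<open>\<epsilon> > 0\<close> by (auto simp: \<eta>_def)
  define bad where "bad n = {\<omega>\<in>space N. \<exists>t\<in>{0..1}.
    \<bar>(interpolate (\<tau> n) (J n) (\<lambda>s. h n s \<omega>) t - c n t) / d n t / lam n - G t \<omega>\<bar> > \<epsilon>}" for n
  define R where "R n = {\<omega>\<in>space N. \<exists>t\<in>{0..1}. \<bar>(h n t \<omega> - c n t) / d n t / lam n - G t \<omega>\<bar> > \<eta>}" for n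
  define E where "E m = {\<omega>\<in>space N. (\<exists>s\<in>{0..1}. \<bar>G s \<omega>\<bar> > real m) \<or>
    (\<exists>s\<in>{0..1}. \<exists>t\<in>{0..1}. \<bar>s - t\<bar> < 1 / real (Suc m) \<and> \<bar>G s \<omega> - G t \<omega>\<bar> > \<eta>)}" for m
  have R_lim: "(\<lambda>n. outer_measure_of N (R n)) \<longlonglongrightarrow> 0"
    using conv \<eta>(1) unfolding prob_sup01_tendsto_zero_iff R_def by blast
  have E_lim: "(\<lambda>m. outer_measure_of N (E m)) \<longlonglongrightarrow> 0"
    unfolding E_def by (rule continuous_process_tight[OF N G \<eta>(1)])
  obtain b where b: "b > 0" "\<And>n. \<bar>lam n\<bar> \<le> b"
    using bdd unfolding bounded_pos by auto
  have sub: "\<forall>\<^sub>F n in sequentially. bad n \<subseteq> R n \<union> E m" for m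
  proof -
    have "\<forall>\<^sub>F n in sequentially. mesh (\<tau> n) (J n) < 1 / real (Suc m)"
      by (intro order_tendstoD(2)[OF mesh]) auto
    moreover have "\<forall>\<^sub>F n in sequentially. \<forall>s\<in>{0..1}. \<forall>t\<in>{0..1}.
      \<bar>s - t\<bar> \<le> mesh (\<tau> n) (J n) \<longrightarrow> \<bar>(c n s - c n t) / d n t\<bar> < \<eta> * lam n"
      using \<eta>(1) by (intro small_oh_sup_nearD[OF c] lam)
    \<comment> \<open>The scale ratio must be within a constant of 1, whereas the hypothesis gives a
      multiple of \<open>lam n\<close>. Dividing by the bound \<open>b\<close> of \<open>lam\<close>
      turns this multiple into at most \<open>\<eta> / (m + 1)\<close>.\<close>
    moreover have "\<forall>\<^sub>F n in sequentially. \<forall>s\<in>{0..1}. \<forall>t\<in>{0..1}.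
      \<bar>s - t\<bar> \<le> mesh (\<tau> n) (J n) \<longrightarrow> \<bar>d n s / d n t - 1\<bar> < \<eta> / (real m + 1) / b * lam n"
      using \<eta> b by (intro small_oh_sup_nearD[OF d] lam) auto
    ultimately show ?thesis
      using eventually_ge_at_top[of 1]
    proof eventually_elim
      case (elim n)
      have n: "n \<ge> 1" by fact
      have "\<eta> / (real m + 1) / b * lam n \<le> \<eta> / (real m + 1) / b * b"
        using \<eta> b(1) b(2)[of n] by (intro mult_left_mono) auto
      then have d_le: "\<eta> / (real m + 1) / b * lam n \<le> \<eta> / (real m + 1)"
        using b by simp
      show ?case
      proof (rule subsetI, rule ccontr)
        fix \<omega> assume "\<omega> \<in> bad n" and good: "\<omega> \<notin> R n \<union> E m"
        then obtain t where \<omega>: "\<omega> \<in> space N" and t: "t \<in> {0..1}" and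
          far: "\<bar>(interpolate (\<tau> n) (J n) (\<lambda>s. h n s \<omega>) t - c n t) / d n t / lam n - G t \<omega>\<bar> > \<epsilon>"
          by (auto simp: bad_def)
        \<comment> \<open>The scaled error at \<open>t\<close> if the interpolated value were
          replaced by the value at the single point \<open>p\<close>.\<close>
        define T where "T p = (h n p \<omega> - c n t) / d n t / lam n - G t \<omega>" for p
        have T: "\<bar>T p\<bar> \<le> \<epsilon>" if p: "p \<in> {0..1}" "\<bar>p - t\<bar> \<le> mesh (\<tau> n) (J n)" for p
        proof -
          have "\<bar>T p\<bar> \<le> 4 * \<eta>"
            unfolding T_def
          proof (rule interpolation_error_bound[where m = "real m" and d' = "d n p" and G' = "G p \<omega>"])
            show "\<bar>(h n p \<omega> - c n p) / d n p / lam n - G p \<omega>\<bar> \<le> \<eta>"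
              using good \<omega> p(1) unfolding R_def not_less[symmetric] by blast
            show "\<bar>G p \<omega>\<bar> \<le> real m"
              using good \<omega> p(1) unfolding E_def not_less[symmetric] by blast
            have "\<bar>p - t\<bar> < 1 / real (Suc m)"
              using p(2) elim(1) by (rule le_less_trans)
            then show "\<bar>G p \<omega> - G t \<omega>\<bar> \<le> \<eta>"
              using good \<omega> p(1) t unfolding E_def not_less[symmetric] by blast
            show "\<bar>(c n p - c n t) / d n t\<bar> < \<eta> * lam n"
              using elim(2) p t by blast
            have "\<bar>d n p / d n t - 1\<bar> < \<eta> / (real m + 1) / b * lam n"
              using elim(3) p t by blast
            then show "\<bar>d n p / d n t - 1\<bar> \<le> \<eta> / (real m + 1)"
              using d_le by linarith
          qed (use \<eta> n lam d_pos p t in auto)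
          then show ?thesis
            using \<eta> by linarith
        qed
        obtain p q w where pq: "p \<in> {0..1}" "q \<in> {0..1}" "\<bar>p - t\<bar> \<le> mesh (\<tau> n) (J n)"
            "\<bar>q - t\<bar> \<le> mesh (\<tau> n) (J n)" and w: "w \<in> {0..1}"
          and interp: "\<And>z. interpolate (\<tau> n) (J n) z t = w * z p + (1 - w) * z q"
          using interpolate_convex_combination[OF J[OF n] grid[OF n] mono[OF n] t] by metis
        \<comment> \<open>The scaled error is affine in the estimator value and the weights sum to
          one, so \<open>c n t\<close> and \<open>G t \<omega>\<close> pass through the convex
          combination.\<close>
        have "(interpolate (\<tau> n) (J n) (\<lambda>s. h n s \<omega>) t - c n t) / d n t / lam n - G t \<omega>
            = w * T p + (1 - w) * T q"
          using d_pos[OF n t] lam[OF n] unfolding interp T_def by (simp add: field_simps)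
        moreover have "\<bar>w * T p + (1 - w) * T q\<bar> \<le> w * \<epsilon> + (1 - w) * \<epsilon>"
          using w T[OF pq(1,3)] T[OF pq(2,4)]
          by (intro order.trans[OF abs_triangle_ineq] add_mono) (auto simp: abs_mult intro!: mult_left_mono)
        ultimately show False
          using far by (simp add: algebra_simps)
      qed
    qed
  qed
  have "(\<lambda>n. outer_measure_of N (bad n)) \<longlonglongrightarrow> 0"
  proof (rule order_tendstoI)
    fix e :: ennreal assume "0 < e"
    then have "0 < e / 2"
      by (simp add: ennreal_zero_less_divide)
    \<comment> \<open>\<open>m\<close> is fixed here from the limit process alone; how large
      \<open>n\<close> has to be then depends on it.\<close>
    obtain m where m: "outer_measure_of N (E m) < e / 2"
      using eventually_happens'[OF _ order_tendstoD(2)[OF E_lim \<open>0 < e / 2\<close>]] by auto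
    show "\<forall>\<^sub>F n in sequentially. outer_measure_of N (bad n) < e"
      using sub[of m] order_tendstoD(2)[OF R_lim \<open>0 < e / 2\<close>]
    proof eventually_elim
      case (elim n)
      have "outer_measure_of N (bad n) \<le> outer_measure_of N (R n \<union> E m)"
        using elim by (intro outer_measure_of_mono)
      also have "\<dots> \<le> outer_measure_of N (R n) + outer_measure_of N (E m)"
        by (rule outer_measure_of_Un_le) (auto simp: R_def E_def)
      also have "\<dots> < e / 2 + e / 2"
        using elim m by (intro add_strict_mono)
      also have "\<dots> = e * 2 / 2"
        by (simp only: add_divide_distrib_ennreal mult_2_right)
      also have "\<dots> = e"
        by (rule mult_divide_eq_ennreal) auto
      finally show ?case .
    qed
  qed simp
  then show "(\<lambda>n. outer_measure_of N {\<omega>\<in>space N. \<exists>t\<in>{0..1}.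
    \<bar>(interpolate (\<tau> n) (J n) (\<lambda>s. h n s \<omega>) t - c n t) / d n t / lam n - G t \<omega>\<bar> > \<epsilon>}) \<longlonglongrightarrow> 0"
    by (simp only: bad_def)
qed

section \<open>Specialization to index, scale and location\<close>

theorem theorem2p1:
  fixes M :: "'a measure" and L :: "'b measure" and N :: "'c measure"
    and X :: "nat \<Rightarrow> real \<Rightarrow> 'a \<Rightarrow> real" and Y :: "real \<Rightarrow> 'b \<Rightarrow> real"
    and U a :: "real \<Rightarrow> real \<Rightarrow> real" and \<gamma> :: "real \<Rightarrow> real"
    and k :: "nat \<Rightarrow> nat"
    and J :: "nat \<Rightarrow> nat" and \<tau> :: "nat \<Rightarrow> nat \<Rightarrow> real" and \<delta> lam :: "nat \<Rightarrow> real"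
    and g_est a_est U_est :: "nat \<Rightarrow> real \<Rightarrow> (nat \<Rightarrow> real) \<Rightarrow> real"
    and g_hat a_hat U_hat :: "nat \<Rightarrow> real \<Rightarrow> 'c \<Rightarrow> real"
    and \<Gamma> A B :: "real \<Rightarrow> 'c \<Rightarrow> real"
  assumes "prob_space M" "prob_space L" "prob_space N"
    \<comment> \<open>the observed processes and their domain of attraction condition\<close>
    and "\<And>i. i \<ge> 1 \<Longrightarrow> continuous_process M (X i)"
    and "iid_processes M X {1..}"
    and "U = tail_quantile M (X 1)"
    and "\<And>t u. t \<in> {0..1} \<Longrightarrow> u > 0 \<Longrightarrow> a t u > 0"
    and "weak_conv_C01 M (\<lambda>n. normalized_max X (\<lambda>t. a t (real n)) (\<lambda>t. U t (real n)) n) L Y"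
    and "max_stable L Y"
    and "continuous_on {0..1} \<gamma>"
    and "\<And>t y. t \<in> {0..1} \<Longrightarrow> 1 + \<gamma> t * y > 0 \<Longrightarrow>
           cdf (distr L borel (Y t)) y = gev_cdf (\<gamma> t) y"
    \<comment> \<open>the intermediate sequence\<close>
    and "\<And>n. n \<ge> 1 \<Longrightarrow> k n \<in> {1..n}"
    and "filterlim k at_top sequentially"
    and "(\<lambda>n. real (k n) / real n) \<longlonglongrightarrow> 0"
    \<comment> \<open>the grids\<close>
    and "\<And>n. n \<ge> 1 \<Longrightarrow> J n \<ge> 1"
    and "\<And>n j. n \<ge> 1 \<Longrightarrow> j \<in> {1..J n} \<Longrightarrow> \<tau> n j \<in> {0..1}"
    and "\<And>n. n \<ge> 1 \<Longrightarrow> strict_mono_on {1..J n} (\<tau> n)"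
    and "\<delta> = (\<lambda>n. mesh (\<tau> n) (J n))"
    and "\<delta> \<longlonglongrightarrow> 0"
    \<comment> \<open>the rate\<close>
    and "\<And>n. n \<ge> 1 \<Longrightarrow> lam n > 0"
    and "bounded (range lam)"
    \<comment> \<open>the estimators, and versions of them on the space N\<close>
    and "\<And>n t. n \<ge> 1 \<Longrightarrow> t \<in> {0..1} \<Longrightarrow> g_est n t \<in> borel_measurable (Pi\<^sub>M {1..n} (\<lambda>_. borel))"
    and "\<And>n t. n \<ge> 1 \<Longrightarrow> t \<in> {0..1} \<Longrightarrow> a_est n t \<in> borel_measurable (Pi\<^sub>M {1..n} (\<lambda>_. borel))"
    and "\<And>n t. n \<ge> 1 \<Longrightarrow> t \<in> {0..1} \<Longrightarrow> U_est n t \<in> borel_measurable (Pi\<^sub>M {1..n} (\<lambda>_. borel))"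
    and "\<And>n. n \<ge> 1 \<Longrightarrow>
           version_of N (\<lambda>t \<omega>. (g_hat n t \<omega>, a_hat n t \<omega>, U_hat n t \<omega>))
             M (\<lambda>t \<omega>. let x = (\<lambda>i\<in>{1..n}. X i t \<omega>) in (g_est n t x, a_est n t x, U_est n t x))"
    and "continuous_process N \<Gamma>" "continuous_process N A" "continuous_process N B"
    \<comment> \<open>uniform convergence of the estimators\<close>
    and "tendsto_zero_in_prob N (\<lambda>n \<omega>. sup01 (\<lambda>t. (g_hat n t \<omega> - \<gamma> t) / lam n - \<Gamma> t \<omega>))"
    and "tendsto_zero_in_prob N (\<lambda>n \<omega>. sup01 (\<lambda>t.
           (a_hat n t \<omega> / a t (real n / real (k n)) - 1) / lam n - A t \<omega>))"
    and "tendsto_zero_in_prob N (\<lambda>n \<omega>. sup01 (\<lambda>t.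
           ((U_hat n t \<omega> - U t (real n / real (k n))) / a t (real n / real (k n))) / lam n - B t \<omega>))"
    \<comment> \<open>regularity over the mesh\<close>
    and "small_oh (\<lambda>n. sup_near (\<delta> n) (\<lambda>s t. \<gamma> s - \<gamma> t)) lam"
    and "small_oh (\<lambda>n. sup_near (\<delta> n) (\<lambda>s t.
           a s (real n / real (k n)) / a t (real n / real (k n)) - 1)) lam"
    and "small_oh (\<lambda>n. sup_near (\<delta> n) (\<lambda>s t.
           (U s (real n / real (k n)) - U t (real n / real (k n))) / a t (real n / real (k n)))) lam"
  shows "tendsto_zero_in_prob N (\<lambda>n \<omega>. sup01 (\<lambda>t.
           (interpolate (\<tau> n) (J n) (\<lambda>s. g_hat n s \<omega>) t - \<gamma> t) / lam n - \<Gamma> t \<omega>))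
    \<and> tendsto_zero_in_prob N (\<lambda>n \<omega>. sup01 (\<lambda>t.
           (interpolate (\<tau> n) (J n) (\<lambda>s. a_hat n s \<omega>) t / a t (real n / real (k n)) - 1) / lam n - A t \<omega>))
    \<and> tendsto_zero_in_prob N (\<lambda>n \<omega>. sup01 (\<lambda>t.
           ((interpolate (\<tau> n) (J n) (\<lambda>s. U_hat n s \<omega>) t - U t (real n / real (k n)))
             / a t (real n / real (k n))) / lam n - B t \<omega>))"
proof -
  have mesh: "(\<lambda>n. mesh (\<tau> n) (J n)) \<longlonglongrightarrow> 0"
    using \<open>\<delta> = _\<close> \<open>\<delta> \<longlonglongrightarrow> 0\<close> by simp
  have a_pos: "a t (real n / real (k n)) > 0" if "n \<ge> 1" "t \<in> {0..1}" for n t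
    using assms(7)[OF that(2)] assms(12)[OF that(1)] that(1) by simp
  have shift: "x / y - 1 = (x - y) / y" if "y > 0" for x y :: real
    using that by (simp add: field_simps)
  \<comment> \<open>Relative errors become centered ones, with \<open>a\<close> as both centering
    and scale. The rewriting is done under the supremum, where \<open>t\<close> lies in the unit
    interval and \<open>a\<close> is positive.\<close>
  have shift_sup: "sup01 (\<lambda>t. (f t / a t (real n / real (k n)) - 1) / lam n - A t \<omega>) =
      sup01 (\<lambda>t. (f t - a t (real n / real (k n))) / a t (real n / real (k n)) / lam n - A t \<omega>)"
    if "n \<ge> 1" for f n \<omega>
    unfolding sup01_def using a_pos[OF that] by (intro SUP_cong) (auto simp: shift)
  have shift_near: "sup_near (mesh (\<tau> n) (J n)) (\<lambda>s t. a s (real n / real (k n)) / a t (real n / real (k n)) - 1) =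
      sup_near (mesh (\<tau> n) (J n)) (\<lambda>s t. (a s (real n / real (k n)) - a t (real n / real (k n)))
        / a t (real n / real (k n)))"
    if "n \<ge> 1" for n
    unfolding sup_near_def using a_pos[OF that] by (intro SUP_cong) (auto simp: shift)
  note near = assms(32-34)[unfolded assms(18)]
  show ?thesis
  proof (intro conjI)
    \<comment> \<open>For the index the scale is constantly 1, so the ratio condition concerns the
      supremum of the zero function. The pair \<open>(0, 0)\<close> shows that its index set is
      nonempty; an empty extended-real supremum would be \<open>-\<infinity>\<close> instead of
      0.\<close>
    have "small_oh (\<lambda>n. sup_near (mesh (\<tau> n) (J n)) (\<lambda>s t. 1 / 1 - 1)) lam"
    proof (rule small_oh_cong[THEN iffD2])
      fix n :: nat assume n: "n \<ge> 1"
      have "0 \<le> mesh (\<tau> n) (J n)"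
        using grid_gap_le_mesh[of 1 "J n" "\<tau> n"] assms(15)[OF n] assms(16)[OF n, of 1]
        by (auto simp: grid_ext_def)
      then have "(0, 0) \<in> {(s, t). s \<in> {0..1} \<and> t \<in> {0..1} \<and> \<bar>s - t\<bar> \<le> mesh (\<tau> n) (J n)}"
        by simp
      then show "sup_near (mesh (\<tau> n) (J n)) (\<lambda>s t. 1 / 1 - 1) = 0"
        unfolding sup_near_def by (subst SUP_eq_const[where x = 0]) (blast, auto)
    qed (simp add: small_oh_def)
    then have "tendsto_zero_in_prob N (\<lambda>n \<omega>. sup01 (\<lambda>t.
        (interpolate (\<tau> n) (J n) (\<lambda>s. g_hat n s \<omega>) t - \<gamma> t) / 1 / lam n - \<Gamma> t \<omega>))"
      using assms(29) near(1)
      by (intro interpolate_uniform_convergence[where d = "\<lambda>_ _. 1"] assms(3,15-17,20,21,26) mesh) simp_all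
    then show "tendsto_zero_in_prob N (\<lambda>n \<omega>. sup01 (\<lambda>t.
        (interpolate (\<tau> n) (J n) (\<lambda>s. g_hat n s \<omega>) t - \<gamma> t) / lam n - \<Gamma> t \<omega>))"
      by simp
    have a_conv: "tendsto_zero_in_prob N (\<lambda>n \<omega>. sup01 (\<lambda>t.
        (a_hat n t \<omega> - a t (real n / real (k n))) / a t (real n / real (k n)) / lam n - A t \<omega>))"
      by (rule tendsto_zero_in_prob_cong[THEN iffD1, OF shift_sup assms(30)])
    have a_near: "small_oh (\<lambda>n. sup_near (mesh (\<tau> n) (J n)) (\<lambda>s t.
        (a s (real n / real (k n)) - a t (real n / real (k n))) / a t (real n / real (k n)))) lam"
      by (rule small_oh_cong[THEN iffD1, OF shift_near near(2)])
    \<comment> \<open>Centering and scale coincide here, so the single regularity condition on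
      \<open>a\<close> supplies both small-oh premises.\<close>
    have "tendsto_zero_in_prob N (\<lambda>n \<omega>. sup01 (\<lambda>t.
        (interpolate (\<tau> n) (J n) (\<lambda>s. a_hat n s \<omega>) t - a t (real n / real (k n)))
          / a t (real n / real (k n)) / lam n - A t \<omega>))"
      by (intro interpolate_uniform_convergence) (fact assms mesh a_pos near a_conv a_near)+
    then show "tendsto_zero_in_prob N (\<lambda>n \<omega>. sup01 (\<lambda>t.
        (interpolate (\<tau> n) (J n) (\<lambda>s. a_hat n s \<omega>) t / a t (real n / real (k n)) - 1) / lam n - A t \<omega>))"
      by (subst tendsto_zero_in_prob_cong[OF shift_sup])
    \<comment> \<open>Centering \<open>U\<close> and scale \<open>a\<close>: the hypotheses already
      have the required form.\<close>
    show "tendsto_zero_in_prob N (\<lambda>n \<omega>. sup01 (\<lambda>t.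
        ((interpolate (\<tau> n) (J n) (\<lambda>s. U_hat n s \<omega>) t - U t (real n / real (k n)))
          / a t (real n / real (k n))) / lam n - B t \<omega>))"
      by (intro interpolate_uniform_convergence) (fact assms mesh a_pos near)+
  qed
qed

end
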